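(* Let $n\ge 2$ and $k\geq 1$ be integers, let $\rho>0$, and consider the path planning problem for a Reeds-Shepp vehicle with minimum turning radius $\rho$ visiting $n$ waypoints in the given sequence $(s_1,\dots,s_n)$, where the orientation at waypoint $s_i$ must lie in $I_{s_i}=[\theta_{s_i}^{min},\theta_{s_i}^{max}]$ with $\theta_{s_i}^{min}<\theta_{s_i}^{max}$. Then the length of the feasible solution obtained by the algorithm $Approx$ (with $k$ intervals per waypoint) is at most $$Cost_{lb}+3\rho\sum_{i=2}^{n-1}\frac{\theta_{s_i}^{max}-\theta_{s_i}^{min}}{k},$$ where $Cost_{lb}$ is the length of the lower bounding solution computed by $Approx$.
   Context: Reeds-Shepp paths: trajectories of $\dot x=u_1\cos\theta$, $\dot y=u_1\sin\theta$, $\dot\theta=u_2$ with $u_1\in\{-1,+1\}$, $u_2\in[-\frac1\rho,\frac1\rho]$; the length of a path equals its duration; orientations are modulo $2\pi$. Waypoint $i$ is located at $(x_i,y_i)\in\mathbb{R}^2$. For orientations $\theta_i,\theta_j$, $d_{ij}(\theta_i,\theta_j)$ is the length of the shortest Reeds-Shepp path from $(x_i,y_i,\theta_i)$ to $(x_j,y_j,\theta_j)$. Path planning problem (sequence given): find $\theta_{s_i}\in I_{s_i}$, $i=1,\dots,n$, minimizing $\sum_{i=1}^{n-1}d_{s_is_{i+1}}(\theta_{s_i},\theta_{s_{i+1}})$. Algorithm $Approx$: (1) For each waypoint $i$, partition $I_i$ into $k$ intervals $[\phi_{i(j-1)},\phi_{ij}]$, $j=1,\dots,k$, where $\phi_{ij}=\theta_i^{min}+\frac{j}{k}(\theta_i^{max}-\theta_i^{min})$.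 (2) Form a graph with nodes $v_{im}$ ($i=1,\dots,n$, $m=1,\dots,k$), where $v_{im}$ represents waypoint $s_i$ with interval $[\phi_{s_i(m-1)},\phi_{s_im}]$. There is an edge from $v_{im}$ to $v_{(i+1)l}$ for all $i=1,\dots,n-1$ and all $m,l$, with $cost(v_{im},v_{(i+1)l})=\min d_{s_is_{i+1}}(\theta,\theta')$ over $\theta\in[\phi_{s_i(m-1)},\phi_{s_im}]$ and $\theta'\in[\phi_{s_{i+1}(l-1)},\phi_{s_{i+1}l}]$. (3) Find a minimum-cost path $(v_{1m_1^*},v_{2m_2^*},\dots,v_{nm_n^*})$ from some node in $\{v_{1m}\}$ to some node in $\{v_{nm}\}$, and let $Cost_{lb}=\sum_{i=1}^{n-1}cost(v_{im_i^*},v_{(i+1)m_{i+1}^*})$. (4) For $i=1,\dots,n-1$, let $\theta_{s_id}$ and $\theta_{s_{i+1}a}$ be the departure angle at $s_i$ and the arrival angle at $s_{i+1}$ in a minimizer defining $cost(v_{im_i^*},v_{(i+1)m_{i+1}^*})$. Set $\theta_{s_1}=\theta_{s_1d}$ and $\theta_{s_n}=\theta_{s_na}$, and choose $\theta_{s_i}\in\{\theta_{s_ia},\theta_{s_id}\}$ for $i=2,\dots,n-1$ so that $\sum_{i=1}^{n-1}d_{s_is_{i+1}}(\theta_{s_i},\theta_{s_{i+1}})$ is minimized over all such choices. The resulting path is the feasible solution obtained by $Approx$. *)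

theory Defs
  imports "HOL-Analysis.Analysis" "HOL-Library.Real_Mod"
begin

(* Caratheodory trajectories x' = u1 cos th, y' = u1 sin th, th' = u2 on [0,T], written as
   integral equations.  As the controls are bounded, integrability of the right-hand sides is
   the same as (Lebesgue) measurability of u1 and u2, so this is the class of measurable
   controls and absolutely continuous trajectories; cusps (jumps of u1) are allowed. *)
definition rs_trajectory ::
  "real \<Rightarrow> real \<Rightarrow> (real \<Rightarrow> real) \<Rightarrow> (real \<Rightarrow> real) \<Rightarrow> (real \<Rightarrow> real) \<Rightarrow> bool" where
  "rs_trajectory \<rho> T x y \<theta> \<longleftrightarrow> 0 \<le> T \<and>
     (\<exists>u1 u2. \<forall>t\<in>{0..T}.
        u1 t \<in> {-1, 1} \<and> u2 t \<in> {- 1 / \<rho>..1 / \<rho>} \<and>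
        ((\<lambda>\<tau>. u1 \<tau> * cos (\<theta> \<tau>)) has_integral (x t - x 0)) {0..t} \<and>
        ((\<lambda>\<tau>. u1 \<tau> * sin (\<theta> \<tau>)) has_integral (y t - y 0)) {0..t} \<and>
        (u2 has_integral (\<theta> t - \<theta> 0)) {0..t})"

type_synonym config = "(real \<times> real) \<times> real"

(* Positions are matched exactly, orientations modulo 2 pi. *)
definition rs_path_between :: "real \<Rightarrow> config \<Rightarrow> config \<Rightarrow> real \<Rightarrow> bool" where
  "rs_path_between \<rho> p q T \<longleftrightarrow>
     (\<exists>x y \<theta>. rs_trajectory \<rho> T x y \<theta> \<and>
        (x 0, y 0) = fst p \<and> [\<theta> 0 = snd p] (rmod (2 * pi)) \<and>
        (x T, y T) = fst q \<and> [\<theta> T = snd q] (rmod (2 * pi)))"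

(* The length of a path is its duration T (unit speed); the infimum is attained by a
   shortest path (Reeds and Shepp). *)
definition rs_dist :: "real \<Rightarrow> config \<Rightarrow> config \<Rightarrow> real" where
  "rs_dist \<rho> p q = Inf {T. rs_path_between \<rho> p q T}"

(* Waypoint i has position pos i and admissible orientations {lo i..hi i}. *)
definition wp_dist ::
  "real \<Rightarrow> (nat \<Rightarrow> real \<times> real) \<Rightarrow> nat \<Rightarrow> nat \<Rightarrow> real \<Rightarrow> real \<Rightarrow> real" where
  "wp_dist \<rho> pos i j \<theta> \<theta>' = rs_dist \<rho> (pos i, \<theta>) (pos j, \<theta>')"

definition breakpoint ::
  "(nat \<Rightarrow> real) \<Rightarrow> (nat \<Rightarrow> real) \<Rightarrow> nat \<Rightarrow> nat \<Rightarrow> nat \<Rightarrow> real" where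
  "breakpoint lo hi k i j = lo i + real j / real k * (hi i - lo i)"

definition subinterval ::
  "(nat \<Rightarrow> real) \<Rightarrow> (nat \<Rightarrow> real) \<Rightarrow> nat \<Rightarrow> nat \<Rightarrow> nat \<Rightarrow> real set" where
  "subinterval lo hi k i m = {breakpoint lo hi k i (m - 1)..breakpoint lo hi k i m}"

(* A node (i, m) stands for the i-th waypoint s i of the sequence with its m-th subinterval. *)
type_synonym node = "nat \<times> nat"

definition node_interval ::
  "(nat \<Rightarrow> real) \<Rightarrow> (nat \<Rightarrow> real) \<Rightarrow> (nat \<Rightarrow> nat) \<Rightarrow> nat \<Rightarrow> node \<Rightarrow> real set" where
  "node_interval lo hi s k v = subinterval lo hi k (s (fst v)) (snd v)"

definition approx_edges :: "nat \<Rightarrow> nat \<Rightarrow> (node \<times> node) set" where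
  "approx_edges n k =
     {((i, m), (i + 1, l)) | i m l. i \<in> {1..n - 1} \<and> m \<in> {1..k} \<and> l \<in> {1..k}}"

(* Minimum of a function that is continuous in the two angles over a compact rectangle. *)
definition edge_cost ::
  "real \<Rightarrow> (nat \<Rightarrow> real \<times> real) \<Rightarrow> (nat \<Rightarrow> real) \<Rightarrow> (nat \<Rightarrow> real) \<Rightarrow> (nat \<Rightarrow> nat) \<Rightarrow> nat \<Rightarrow>
   node \<Rightarrow> node \<Rightarrow> real" where
  "edge_cost \<rho> pos lo hi s k v w =
     (INF (\<theta>, \<theta>') \<in> node_interval lo hi s k v \<times> node_interval lo hi s k w.
        wp_dist \<rho> pos (s (fst v)) (s (fst w)) \<theta> \<theta>')"

definition edge_minimizer ::
  "real \<Rightarrow> (nat \<Rightarrow> real \<times> real) \<Rightarrow> (nat \<Rightarrow> real) \<Rightarrow> (nat \<Rightarrow> real) \<Rightarrow> (nat \<Rightarrow> nat) \<Rightarrow> nat \<Rightarrow>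
   node \<Rightarrow> node \<Rightarrow> real \<times> real \<Rightarrow> bool" where
  "edge_minimizer \<rho> pos lo hi s k v w =
     is_arg_min (\<lambda>(\<theta>, \<theta>'). wp_dist \<rho> pos (s (fst v)) (s (fst w)) \<theta> \<theta>')
       (\<lambda>(\<theta>, \<theta>'). \<theta> \<in> node_interval lo hi s k v \<and> \<theta>' \<in> node_interval lo hi s k w)"

definition approx_path :: "nat \<Rightarrow> nat \<Rightarrow> node list \<Rightarrow> bool" where
  "approx_path n k p \<longleftrightarrow> p \<noteq> [] \<and> hd p \<in> {1} \<times> {1..k} \<and> last p \<in> {n} \<times> {1..k} \<and>
     successively (\<lambda>v w. (v, w) \<in> approx_edges n k) p"

definition path_cost :: "(node \<Rightarrow> node \<Rightarrow> real) \<Rightarrow> node list \<Rightarrow> real" where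
  "path_cost c p = (\<Sum>i<length p - 1. c (p ! i) (p ! (i + 1)))"

definition tour_length ::
  "real \<Rightarrow> (nat \<Rightarrow> real \<times> real) \<Rightarrow> (nat \<Rightarrow> nat) \<Rightarrow> nat \<Rightarrow> (nat \<Rightarrow> real) \<Rightarrow> real" where
  "tour_length \<rho> pos s n \<theta> =
     (\<Sum>i=1..n - 1. wp_dist \<rho> pos (s i) (s (i + 1)) (\<theta> (s i)) (\<theta> (s (i + 1))))"

definition angle_choice ::
  "(nat \<Rightarrow> nat) \<Rightarrow> nat \<Rightarrow> (nat \<Rightarrow> real) \<Rightarrow> (nat \<Rightarrow> real) \<Rightarrow> (nat \<Rightarrow> real) \<Rightarrow> bool" where
  "angle_choice s n \<theta>d \<theta>a \<theta> \<longleftrightarrow> \<theta> (s 1) = \<theta>d (s 1) \<and> \<theta> (s n) = \<theta>a (s n) \<and>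
     (\<forall>i\<in>{2..n - 1}. \<theta> (s i) \<in> {\<theta>a (s i), \<theta>d (s i)})"

(* A relation rather than a function, since minimum-cost paths, edge minimizers and optimal
   choices need not be unique: Cost_lb and the orientations th are a possible outcome of a run.
   Orientations (th, and departure / arrival angles thd, tha) are indexed by waypoints. *)
definition approx_output ::
  "real \<Rightarrow> (nat \<Rightarrow> real \<times> real) \<Rightarrow> (nat \<Rightarrow> real) \<Rightarrow> (nat \<Rightarrow> real) \<Rightarrow> (nat \<Rightarrow> nat) \<Rightarrow> nat \<Rightarrow> nat \<Rightarrow>
   real \<Rightarrow> (nat \<Rightarrow> real) \<Rightarrow> bool" where
  "approx_output \<rho> pos lo hi s n k Cost_lb \<theta> \<longleftrightarrow>
     (\<exists>m \<theta>d \<theta>a.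
        is_arg_min (path_cost (edge_cost \<rho> pos lo hi s k)) (approx_path n k)
          (map (\<lambda>i. (i, m i)) [1..<n + 1]) \<and>
        Cost_lb = (\<Sum>i=1..n - 1. edge_cost \<rho> pos lo hi s k (i, m i) (i + 1, m (i + 1))) \<and>
        (\<forall>i\<in>{1..n - 1}. edge_minimizer \<rho> pos lo hi s k (i, m i) (i + 1, m (i + 1))
           (\<theta>d (s i), \<theta>a (s (i + 1)))) \<and>
        is_arg_min (tour_length \<rho> pos s n) (angle_choice s n \<theta>d \<theta>a) \<theta>)"

end

theory Submission
  imports Defs
begin

text \<open>A Reeds-Shepp vehicle can turn in place by any angle \<open>\<delta>\<close> within length \<open>\<rho> \<bar>\<delta>\<bar>\<close>:
  it follows three arcs that all rotate it in the same sense, driving in directions \<open>+\<close>, \<open>-\<close>,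
  \<open>+\<close>; the displacements cancel if the outer arcs are equal and the middle arc \<open>b\<close> satisfies
  \<open>2 sin (b / 2) = sin (\<delta> / 2)\<close>. So \<open>wp_dist\<close> changes by at most \<open>\<rho> \<bar>\<delta>\<bar>\<close> when the departure
  angle changes by \<open>\<delta>\<close>. Using the arrival angle at every intermediate waypoint is one of the
  admissible choices, and it exceeds the lower bound by at most \<open>\<rho>\<close> times the sum of the widths
  of the subintervals, which is better than the factor \<open>3\<close> claimed.\<close>

section \<open>Concatenation of paths\<close>

text \<open>Splits the integral at \<open>T\<close> and shifts the second piece back to 0. Only the
  increment of \<open>G\<close> enters \<open>H\<close>, so \<open>G\<close> need not start at the
  value where \<open>F\<close> ends; this leaves room for orientations that match only modulo 2
  pi.\<close>

lemma has_integral_append: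
  fixes f g h F G H :: "real \<Rightarrow> real"
  assumes f: "\<And>t. t \<in> {0..T} \<Longrightarrow> (f has_integral (F t - F 0)) {0..t}"
    and g: "\<And>t. t \<in> {0..T'} \<Longrightarrow> (g has_integral (G t - G 0)) {0..t}"
    and h1: "\<And>t. t \<le> T \<Longrightarrow> h t = f t" and h2: "\<And>t. T < t \<Longrightarrow> h t = g (t - T)"
    and H1: "\<And>t. t \<le> T \<Longrightarrow> H t = F t" and H2: "\<And>t. T < t \<Longrightarrow> H t = F T + (G (t - T) - G 0)"
    and T: "0 \<le> T" and t: "t \<in> {0..T + T'}"
  shows "(h has_integral (H t - H 0)) {0..t}"
proof (cases "t \<le> T")
  case True
  with t have "(f has_integral (F t - F 0)) {0..t}"
    by (intro f) auto
  then have "(h has_integral (F t - F 0)) {0..t}"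
    using True by (elim has_integral_eq[rotated]) (simp add: h1)
  then show ?thesis
    using True T by (simp add: H1)
next
  case False
  have "(f has_integral (F T - F 0)) {0..T}"
    using T by (intro f) auto
  then have "(h has_integral (F T - F 0)) {0..T}"
    by (rule has_integral_eq[rotated]) (simp add: h1)
  moreover have "(g has_integral (G (t - T) - G 0)) {0..t - T}"
    using False t by (intro g) auto
  then have "((\<lambda>\<tau>. g (\<tau> - T)) has_integral (G (t - T) - G 0)) {T..t}"
    using has_integral_shift_real_ivl[of g _ 0 "t - T" "- T"] by simp
  then have "(h has_integral (G (t - T) - G 0)) {T..t}"
    \<comment> \<open>At \<open>T\<close> itself \<open>h\<close> still follows \<open>f\<close> and
      may differ from the shifted \<open>g\<close>; a single point does not affect the
      integral.\<close>
    by (rule has_integral_spike_finite[of "{T}", rotated 2]) (auto simp: h2)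
  ultimately have "(h has_integral (F T - F 0 + (G (t - T) - G 0))) {0..t}"
    using T False by (intro has_integral_combine[of 0 T t]) auto
  then show ?thesis
    using False T by (simp add: H1 H2 algebra_simps)
qed

text \<open>Exposes the controls, which are bound inside \<open>rs_trajectory\<close>, so that those
  of two paths can be spliced.\<close>

definition rs_controlled ::
  "real \<Rightarrow> real \<Rightarrow> (real \<Rightarrow> real) \<Rightarrow> (real \<Rightarrow> real) \<Rightarrow> (real \<Rightarrow> real) \<Rightarrow>
   (real \<Rightarrow> real) \<Rightarrow> (real \<Rightarrow> real) \<Rightarrow> bool" where
  "rs_controlled \<rho> T x y \<theta> u1 u2 \<longleftrightarrow>
     (\<forall>t\<in>{0..T}.
        u1 t \<in> {-1, 1} \<and> u2 t \<in> {- 1 / \<rho>..1 / \<rho>} \<and>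
        ((\<lambda>\<tau>. u1 \<tau> * cos (\<theta> \<tau>)) has_integral (x t - x 0)) {0..t} \<and>
        ((\<lambda>\<tau>. u1 \<tau> * sin (\<theta> \<tau>)) has_integral (y t - y 0)) {0..t} \<and>
        (u2 has_integral (\<theta> t - \<theta> 0)) {0..t})"

lemma rs_trajectory_iff:
  "rs_trajectory \<rho> T x y \<theta> \<longleftrightarrow> 0 \<le> T \<and> (\<exists>u1 u2. rs_controlled \<rho> T x y \<theta> u1 u2)"
  unfolding rs_trajectory_def rs_controlled_def ..

lemma rs_path_between_trans:
  assumes "rs_path_between \<rho> p q T" and "rs_path_between \<rho> q r T'"
  shows "rs_path_between \<rho> p r (T + T')"
proof -
  obtain x y \<theta> u1 u2 where T: "0 \<le> T" and ctrl: "rs_controlled \<rho> T x y \<theta> u1 u2"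
    and p: "(x 0, y 0) = fst p" "[\<theta> 0 = snd p] (rmod (2 * pi))"
    and q: "(x T, y T) = fst q" "[\<theta> T = snd q] (rmod (2 * pi))"
    using assms(1) unfolding rs_path_between_def rs_trajectory_iff by blast
  obtain x' y' \<theta>' v1 v2 where T': "0 \<le> T'" and ctrl': "rs_controlled \<rho> T' x' y' \<theta>' v1 v2"
    and q': "(x' 0, y' 0) = fst q" "[\<theta>' 0 = snd q] (rmod (2 * pi))"
    and r: "(x' T', y' T') = fst r" "[\<theta>' T' = snd r] (rmod (2 * pi))"
    using assms(2) unfolding rs_path_between_def rs_trajectory_iff by blast
  note ctrl = bspec[OF ctrl[unfolded rs_controlled_def]]
    and ctrl' = bspec[OF ctrl'[unfolded rs_controlled_def]]
  note x = ctrl[THEN conjunct2, THEN conjunct2, THEN conjunct1]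
    and y = ctrl[THEN conjunct2, THEN conjunct2, THEN conjunct2, THEN conjunct1]
    and \<theta> = ctrl[THEN conjunct2, THEN conjunct2, THEN conjunct2, THEN conjunct2]
    and x' = ctrl'[THEN conjunct2, THEN conjunct2, THEN conjunct1]
    and y' = ctrl'[THEN conjunct2, THEN conjunct2, THEN conjunct2, THEN conjunct1]
    and \<theta>' = ctrl'[THEN conjunct2, THEN conjunct2, THEN conjunct2, THEN conjunct2]
  define append where "append f g t = (if t \<le> T then f t else g (t - T))" for f g :: "real \<Rightarrow> real" and t
  \<comment> \<open>The mismatch of the two orientation functions at the junction, a multiple of 2
    pi. Lifting the second one by \<open>c\<close> makes the joined orientation continuous and
    leaves all velocities unchanged.\<close>
  define c where "c = \<theta> T - \<theta>' 0"
  have cong: "[a + c = a] (rmod (2 * pi))" for a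
  proof -
    have "[\<theta> T = \<theta>' 0] (rmod (2 * pi))"
      using q(2) q'(2) rcong_sym rcong_trans by blast
    then have "[a + (\<theta> T - \<theta>' 0) = a + (\<theta>' 0 - \<theta>' 0)] (rmod (2 * pi))"
      by (intro rcong_add rcong_diff) auto
    then show ?thesis by (simp add: c_def)
  qed
  have cs: "cos (a + c) = cos a" "sin (a + c) = sin a" for a
    using cis_eq_iff[of "a + c" a] cong[of a] by (auto simp: cis.ctr complex_eq_iff)
  have "(x' 0, y' 0) = (x T, y T)"
    by (simp only: q(1) q'(1))
  then have pos: "x' 0 = x T" "y' 0 = y T"
    by simp_all
  define X Y \<Theta> where "X = append x x'" and "Y = append y y'" and "\<Theta> = append \<theta> (\<lambda>t. \<theta>' t + c)"
  have "rs_trajectory \<rho> (T + T') X Y \<Theta>"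
    unfolding rs_trajectory_iff rs_controlled_def
  proof (intro conjI exI ballI)
    show "0 \<le> T + T'" using T T' by simp
    fix t assume t: "t \<in> {0..T + T'}"
    show "append u1 v1 t \<in> {-1, 1}" "append u2 v2 t \<in> {- 1 / \<rho>..1 / \<rho>}"
      using ctrl[of t] ctrl'[of "t - T"] t by (auto simp: append_def)
    show "((\<lambda>\<tau>. append u1 v1 \<tau> * cos (\<Theta> \<tau>)) has_integral (X t - X 0)) {0..t}"
      by (rule has_integral_append[OF x x' _ _ _ _ T t]) (auto simp: append_def X_def \<Theta>_def cs pos)
    show "((\<lambda>\<tau>. append u1 v1 \<tau> * sin (\<Theta> \<tau>)) has_integral (Y t - Y 0)) {0..t}"
      by (rule has_integral_append[OF y y' _ _ _ _ T t]) (auto simp: append_def Y_def \<Theta>_def cs pos)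
    show "(append u2 v2 has_integral (\<Theta> t - \<Theta> 0)) {0..t}"
      by (rule has_integral_append[OF \<theta> \<theta>' _ _ _ _ T t]) (auto simp: append_def \<Theta>_def c_def)
  qed
  moreover have "X (T + T') = x' T'" "Y (T + T') = y' T'" "\<Theta> (T + T') = \<theta>' T' + c"
    using T T' pos by (auto simp: append_def X_def Y_def \<Theta>_def c_def)
  moreover have "X 0 = x 0" "Y 0 = y 0" "\<Theta> 0 = \<theta> 0"
    using T by (auto simp: append_def X_def Y_def \<Theta>_def)
  ultimately show ?thesis
    unfolding rs_path_between_def using p r rcong_trans[OF cong r(2)]
    by (intro exI[of _ X] exI[of _ Y] exI[of _ \<Theta>]) simp
qed

section \<open>Turning in place\<close>

text \<open>Constant controls \<open>\<sigma>\<close> and \<open>\<epsilon> / \<rho>\<close> trace a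
  circular arc of radius \<open>\<rho>\<close>. Integrating the velocity divides by
  \<open>\<epsilon>\<close>, which is the same as multiplying by it since its square is 1.\<close>

lemma rs_path_between_arc:
  assumes "\<rho> > 0" "a \<ge> 0" "\<sigma> \<in> {-1, 1}" "\<epsilon> \<in> {-1, 1}"
  shows "rs_path_between \<rho> ((X, Y), \<alpha>)
    ((X + \<sigma> * \<epsilon> * \<rho> * (sin (\<alpha> + \<epsilon> * a) - sin \<alpha>), Y - \<sigma> * \<epsilon> * \<rho> * (cos (\<alpha> + \<epsilon> * a) - cos \<alpha>)),
     \<alpha> + \<epsilon> * a) (\<rho> * a)"
proof -
  define x where "x t = X + \<sigma> * \<epsilon> * \<rho> * (sin (\<alpha> + \<epsilon> * t / \<rho>) - sin \<alpha>)" for t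
  define y where "y t = Y - \<sigma> * \<epsilon> * \<rho> * (cos (\<alpha> + \<epsilon> * t / \<rho>) - cos \<alpha>)" for t
  define \<theta> where "\<theta> t = \<alpha> + \<epsilon> * t / \<rho>" for t
  have "rs_trajectory \<rho> (\<rho> * a) x y \<theta>"
    unfolding rs_trajectory_def
  proof (intro conjI exI ballI)
    show "0 \<le> \<rho> * a" using assms by simp
    fix t assume t: "t \<in> {0..\<rho> * a}"
    show "\<sigma> \<in> {-1, 1}" "\<epsilon> / \<rho> \<in> {- 1 / \<rho>..1 / \<rho>}"
      using assms by (auto simp: field_simps)
    have \<epsilon>: "\<epsilon> * \<epsilon> = 1" using assms by auto
    show "((\<lambda>\<tau>. \<sigma> * cos (\<theta> \<tau>)) has_integral (x t - x 0)) {0..t}"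
      unfolding x_def \<theta>_def using t assms(1)
      by (intro fundamental_theorem_of_calculus)
         (auto intro!: derivative_eq_intros simp: \<epsilon> simp flip: has_real_derivative_iff_has_vector_derivative)
    show "((\<lambda>\<tau>. \<sigma> * sin (\<theta> \<tau>)) has_integral (y t - y 0)) {0..t}"
      unfolding y_def \<theta>_def using t assms(1)
      by (intro fundamental_theorem_of_calculus)
         (auto intro!: derivative_eq_intros simp: \<epsilon> simp flip: has_real_derivative_iff_has_vector_derivative)
    show "((\<lambda>_. \<epsilon> / \<rho>) has_integral (\<theta> t - \<theta> 0)) {0..t}"
      unfolding \<theta>_def using t assms(1)
      by (intro fundamental_theorem_of_calculus)
         (auto intro!: derivative_eq_intros simp flip: has_real_derivative_iff_has_vector_derivative)
  qed
  then show ?thesis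
    unfolding rs_path_between_def using assms(1)
    by (intro exI[of _ x] exI[of _ y] exI[of _ \<theta>]) (auto simp: x_def y_def \<theta>_def)
qed

lemma rs_path_between_turn:
  assumes "\<rho> > 0" "0 \<le> \<delta>" "\<delta> \<le> 2 * pi" "\<epsilon> \<in> {-1, 1}"
  shows "rs_path_between \<rho> (P, \<alpha>) (P, \<alpha> + \<epsilon> * \<delta>) (\<rho> * \<delta>)"
proof -
  obtain X Y where P: "P = (X, Y)" by fastforce
  have "sin (\<delta> / 2) \<ge> 0"
    using assms by (intro sin_ge_zero) auto
  \<comment> \<open>Intermediate value theorem: 2 sin (b / 2) is 0 at b = 0 and 2 sin (\<delta> / 2)
    at b = \<delta>, and sin (\<delta> / 2) lies between these because it is nonnegative. This is
    where \<delta> \<le> 2 pi enters.\<close>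
  then have "\<exists>b\<ge>0. b \<le> \<delta> \<and> 2 * sin (b / 2) = sin (\<delta> / 2)"
    using assms by (intro IVT') (auto intro!: continuous_intros)
  then obtain b where b: "0 \<le> b" "b \<le> \<delta>" "2 * sin (b / 2) = sin (\<delta> / 2)"
    by blast
  define a where "a = (\<delta> - b) / 2"
  \<comment> \<open>The orientation halfway through the turn. The four arc endpoints have
    orientations symmetric about it.\<close>
  define \<mu> where "\<mu> = \<alpha> + \<epsilon> * \<delta> / 2"
  have 1: "\<alpha> = \<mu> - \<epsilon> * \<delta> / 2" "\<alpha> + \<epsilon> * a = \<mu> - \<epsilon> * b / 2"
    "\<alpha> + \<epsilon> * a + \<epsilon> * b = \<mu> + \<epsilon> * b / 2" "\<alpha> + \<epsilon> * a + \<epsilon> * b + \<epsilon> * a = \<mu> + \<epsilon> * \<delta> / 2"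
    by (simp_all add: \<mu>_def a_def field_simps)
  \<comment> \<open>By the addition formulas both sides are multiples of cos \<mu> (respectively sin
    \<mu>), and the remaining factors agree by the choice of \<open>b\<close>.\<close>
  have 2: "sin (\<mu> + \<epsilon> * \<delta> / 2) - sin (\<mu> - \<epsilon> * \<delta> / 2) = 2 * (sin (\<mu> + \<epsilon> * b / 2) - sin (\<mu> - \<epsilon> * b / 2))"
    "cos (\<mu> + \<epsilon> * \<delta> / 2) - cos (\<mu> - \<epsilon> * \<delta> / 2) = 2 * (cos (\<mu> + \<epsilon> * b / 2) - cos (\<mu> - \<epsilon> * b / 2))"
    using assms(4) by (auto simp: sin_add cos_add sin_diff cos_diff simp flip: b(3))
  note arc = rs_path_between_arc[OF assms(1) _ _ assms(4)]
  have "a \<ge> 0" using b by (simp add: a_def)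
  from rs_path_between_trans[OF rs_path_between_trans[OF
      arc[OF this, of 1 X Y \<alpha>] arc[OF b(1), of "-1"]] arc[OF this, of 1]]
  have path: "rs_path_between \<rho> ((X, Y), \<alpha>)
      ((X + \<epsilon> * \<rho> * (sin (\<alpha> + \<epsilon> * a) - sin \<alpha>)
          - \<epsilon> * \<rho> * (sin (\<alpha> + \<epsilon> * a + \<epsilon> * b) - sin (\<alpha> + \<epsilon> * a))
          + \<epsilon> * \<rho> * (sin (\<alpha> + \<epsilon> * a + \<epsilon> * b + \<epsilon> * a) - sin (\<alpha> + \<epsilon> * a + \<epsilon> * b)),
        Y - \<epsilon> * \<rho> * (cos (\<alpha> + \<epsilon> * a) - cos \<alpha>)
          + \<epsilon> * \<rho> * (cos (\<alpha> + \<epsilon> * a + \<epsilon> * b) - cos (\<alpha> + \<epsilon> * a))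
          - \<epsilon> * \<rho> * (cos (\<alpha> + \<epsilon> * a + \<epsilon> * b + \<epsilon> * a) - cos (\<alpha> + \<epsilon> * a + \<epsilon> * b))),
       \<alpha> + \<epsilon> * a + \<epsilon> * b + \<epsilon> * a) (\<rho> * a + \<rho> * b + \<rho> * a)"
    (is "rs_path_between _ _ ((?X, ?Y), _) _")
    by simp
  have "?X = X + \<epsilon> * \<rho> * ((sin (\<mu> + \<epsilon> * \<delta> / 2) - sin (\<mu> - \<epsilon> * \<delta> / 2))
      - 2 * (sin (\<mu> + \<epsilon> * b / 2) - sin (\<mu> - \<epsilon> * b / 2)))"
    \<comment> \<open>Each left-hand side in \<open>1\<close> contains the preceding one, so the
      longest has to be rewritten first.\<close>
    unfolding 1(4) unfolding 1(3) unfolding 1(2) unfolding 1(1) by (simp add: algebra_simps)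
  then have X: "?X = X" unfolding 2 by simp
  have "?Y = Y - \<epsilon> * \<rho> * ((cos (\<mu> + \<epsilon> * \<delta> / 2) - cos (\<mu> - \<epsilon> * \<delta> / 2))
      - 2 * (cos (\<mu> + \<epsilon> * b / 2) - cos (\<mu> - \<epsilon> * b / 2)))"
    unfolding 1(4) unfolding 1(3) unfolding 1(2) unfolding 1(1) by (simp add: algebra_simps)
  then have Y: "?Y = Y" unfolding 2 by simp
  have "\<alpha> + \<epsilon> * a + \<epsilon> * b + \<epsilon> * a = \<alpha> + \<epsilon> * \<delta>" "\<rho> * a + \<rho> * b + \<rho> * a = \<rho> * \<delta>"
    by (simp_all add: a_def field_simps)
  with path[unfolded X Y] show ?thesis by (simp only: P)
qed

lemma rs_path_between_cong_right:
  assumes "rs_path_between \<rho> p (Q, \<beta>) T" "[\<beta> = \<beta>'] (rmod (2 * pi))"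
  shows "rs_path_between \<rho> p (Q, \<beta>') T"
  using assms rcong_trans unfolding rs_path_between_def fst_conv snd_conv by blast

text \<open>The three-arc turn covers angles up to 2 pi; a larger angle is first reduced modulo 2
  pi, which keeps the final orientation and only shortens the path.\<close>

lemma rs_path_between_turn_le:
  assumes "\<rho> > 0"
  obtains T where "rs_path_between \<rho> (P, \<alpha>) (P, \<beta>) T" "T \<le> \<rho> * \<bar>\<alpha> - \<beta>\<bar>"
proof -
  define \<epsilon> :: real where "\<epsilon> = (if \<alpha> \<le> \<beta> then 1 else -1)"
  have \<epsilon>: "\<epsilon> \<in> {-1, 1}" "\<beta> = \<alpha> + \<epsilon> * \<bar>\<alpha> - \<beta>\<bar>"
    by (auto simp: \<epsilon>_def)
  define r where "r = \<bar>\<alpha> - \<beta>\<bar> rmod (2 * pi)"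
  have r: "0 \<le> r" "r \<le> 2 * pi"
    by (simp_all add: r_def rmod_nonneg rmod_le)
  have "r \<le> \<bar>\<alpha> - \<beta>\<bar>"
    by (simp add: r_def rmod_def)
  then have "\<rho> * r \<le> \<rho> * \<bar>\<alpha> - \<beta>\<bar>"
    using assms by simp
  moreover have "[\<alpha> + \<epsilon> * r = \<beta>] (rmod (2 * pi))"
  proof -
    have "[r = \<bar>\<alpha> - \<beta>\<bar>] (rmod (2 * pi))" by (simp add: r_def)
    then have "[\<alpha> + \<epsilon> * r = \<alpha> + \<epsilon> * \<bar>\<alpha> - \<beta>\<bar>] (rmod (2 * pi))"
      using \<epsilon>(1) by auto
    then show ?thesis using \<epsilon>(2) by simp
  qed
  then have "rs_path_between \<rho> (P, \<alpha>) (P, \<beta>) (\<rho> * r)"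
    by (rule rs_path_between_cong_right[OF rs_path_between_turn[OF assms r \<epsilon>(1)]])
  ultimately show ?thesis
    by (rule that[rotated])
qed

text \<open>No reachability is needed: if there is no path at all, both sides contain the same junk
  value \<open>Inf {}\<close>.\<close>

lemma rs_dist_turn_le:
  assumes "\<rho> > 0"
  shows "rs_dist \<rho> (P, \<alpha>) q \<le> \<rho> * \<bar>\<alpha> - \<beta>\<bar> + rs_dist \<rho> (P, \<beta>) q"
proof (cases "{T. rs_path_between \<rho> (P, \<beta>) q T} = {}")
  case True
  \<comment> \<open>A path to \<open>q\<close> starting at \<alpha> could be preceded by the turn
    from \<beta> to \<alpha>, giving a path starting at \<beta>.\<close>
  then have "{T. rs_path_between \<rho> (P, \<alpha>) q T} = {}"
    by (auto intro: rs_path_between_turn_le[OF assms, of P \<beta> \<alpha>] dest: rs_path_between_trans)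
  with True show ?thesis
    unfolding rs_dist_def using assms by (simp only: le_add_same_cancel2) simp
next
  case False
  obtain T where T: "rs_path_between \<rho> (P, \<alpha>) (P, \<beta>) T" "T \<le> \<rho> * \<bar>\<alpha> - \<beta>\<bar>"
    using rs_path_between_turn_le[OF assms] .
  have bdd: "bdd_below {T. rs_path_between \<rho> (P, \<alpha>) q T}"
    by (rule bdd_belowI[of _ 0]) (auto simp: rs_path_between_def rs_trajectory_def)
  \<comment> \<open>With \<open>T\<close> on the left, the claim is a lower bound for every path
    from \<beta>, hence for their infimum.\<close>
  have "rs_dist \<rho> (P, \<alpha>) q - T \<le> rs_dist \<rho> (P, \<beta>) q"
    unfolding rs_dist_def[of _ "(P, \<beta>)"]
  proof (rule cInf_greatest[OF False])
    fix T' assume "T' \<in> {T. rs_path_between \<rho> (P, \<beta>) q T}"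
    then have "rs_dist \<rho> (P, \<alpha>) q \<le> T + T'"
      unfolding rs_dist_def using rs_path_between_trans[OF T(1)] by (intro cInf_lower[OF _ bdd]) simp
    then show "rs_dist \<rho> (P, \<alpha>) q - T \<le> T'" by simp
  qed
  with T(2) show ?thesis by simp
qed

section \<open>The algorithm\<close>

lemma edge_cost_eq_minimizer:
  assumes "edge_minimizer \<rho> pos lo hi s k v w (\<theta>, \<theta>')"
  shows "edge_cost \<rho> pos lo hi s k v w = wp_dist \<rho> pos (s (fst v)) (s (fst w)) \<theta> \<theta>'"
    and "\<theta> \<in> node_interval lo hi s k v" and "\<theta>' \<in> node_interval lo hi s k w"
  unfolding edge_cost_def using assms
  by (auto simp: edge_minimizer_def is_arg_min_linorder intro!: cInf_eq_minimum)

lemma node_interval_dist_le: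
  assumes "a \<in> node_interval lo hi s k (i, m)" "b \<in> node_interval lo hi s k (i, m)"
    and "lo (s i) \<le> hi (s i)"
  shows "\<bar>a - b\<bar> \<le> (hi (s i) - lo (s i)) / real k"
proof -
  have "breakpoint lo hi k (s i) m - breakpoint lo hi k (s i) (m - 1)
      = (real m - real (m - 1)) * ((hi (s i) - lo (s i)) / real k)"
    by (simp add: breakpoint_def algebra_simps diff_divide_distrib)
  \<comment> \<open>The factor is 1 for positive \<open>m\<close>, and 0 for \<open>m = 0\<close> by
    truncated subtraction.\<close>
  also have "\<dots> \<le> 1 * ((hi (s i) - lo (s i)) / real k)"
    using assms(3) by (intro mult_right_mono) auto
  finally show ?thesis
    using assms(1,2) by (auto simp: node_interval_def subinterval_def)
qed

theorem theorem2:
  fixes n k :: nat and \<rho> :: real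
    and s :: "nat \<Rightarrow> nat"
    and pos :: "nat \<Rightarrow> real \<times> real"
    and lo hi :: "nat \<Rightarrow> real"
    and Cost_lb :: real and \<theta> :: "nat \<Rightarrow> real"
  assumes "n \<ge> 2" and "k \<ge> 1" and "\<rho> > 0"
    and "bij_betw s {1..n} {1..n}"
    and "\<And>i. i \<in> {1..n} \<Longrightarrow> lo (s i) < hi (s i)"
    and "approx_output \<rho> pos lo hi s n k Cost_lb \<theta>"
  shows "tour_length \<rho> pos s n \<theta>
           \<le> Cost_lb + 3 * \<rho> * (\<Sum>i=2..n - 1. (hi (s i) - lo (s i)) / real k)"
proof -
  let ?w = "\<lambda>i. (hi (s i) - lo (s i)) / real k"
  let ?d = "\<lambda>i. wp_dist \<rho> pos (s i) (s (i + 1))"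
  obtain m \<theta>d \<theta>a where
    lb: "Cost_lb = (\<Sum>i=1..n - 1. edge_cost \<rho> pos lo hi s k (i, m i) (i + 1, m (i + 1)))"
    and mini: "\<And>i. i \<in> {1..n - 1} \<Longrightarrow>
      edge_minimizer \<rho> pos lo hi s k (i, m i) (i + 1, m (i + 1)) (\<theta>d (s i), \<theta>a (s (i + 1)))"
    and opt: "is_arg_min (tour_length \<rho> pos s n) (angle_choice s n \<theta>d \<theta>a) \<theta>"
    using assms(6) unfolding approx_output_def by blast
  note mini = edge_cost_eq_minimizer[OF mini]
  \<comment> \<open>Orientations are indexed by waypoints, so changing the value at
    \<open>s 1\<close> must not disturb any later position.\<close>
  have inj: "s i = s j \<longleftrightarrow> i = j" if "i \<in> {1..n}" "j \<in> {1..n}" for i j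
    using inj_on_eq_iff[OF bij_betw_imp_inj_on[OF assms(4)] that] .
  \<comment> \<open>Arrival angles everywhere except at the first waypoint, where there is only a
    departure angle.\<close>
  define \<phi> where "\<phi> = \<theta>a(s 1 := \<theta>d (s 1))"
  have \<phi>: "\<phi> (s i) = \<theta>a (s i)" if "i \<in> {2..n}" for i
    using inj[of i 1] that by (auto simp: \<phi>_def)
  have "angle_choice s n \<theta>d \<theta>a \<phi>"
    unfolding angle_choice_def using \<phi> assms(1) by (auto simp: \<phi>_def)
  then have "tour_length \<rho> pos s n \<theta> \<le> tour_length \<rho> pos s n \<phi>"
    using opt by (simp add: is_arg_min_linorder)
  \<comment> \<open>Each leg ends at its optimal arrival angle, so only its departure angle is
    perturbed. The first leg also departs optimally and costs nothing extra.\<close>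
  also have "\<dots> \<le> (\<Sum>i=1..n - 1. ?d i (\<theta>d (s i)) (\<theta>a (s (i + 1))) + (if i = 1 then 0 else \<rho> * ?w i))"
    unfolding tour_length_def
  proof (rule sum_mono)
    fix i assume i: "i \<in> {1..n - 1}"
    have next_angle: "\<phi> (s (i + 1)) = \<theta>a (s (i + 1))"
      using i by (intro \<phi>) auto
    show "?d i (\<phi> (s i)) (\<phi> (s (i + 1)))
        \<le> ?d i (\<theta>d (s i)) (\<theta>a (s (i + 1))) + (if i = 1 then 0 else \<rho> * ?w i)"
    proof (cases "i = 1")
      case True
      with next_angle show ?thesis by (simp add: \<phi>_def)
    next
      case False
      \<comment> \<open>The arrival angle stems from edge \<open>i - 1\<close> and the departure
        angle from edge \<open>i\<close>; these edges share the node \<open>(i, m i)\<close>, so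
        both angles lie in one subinterval.\<close>
      have "\<theta>a (s i) \<in> node_interval lo hi s k (i, m i)"
      proof -
        have "i - 1 \<in> {1..n - 1}" "i - 1 + 1 = i" using i False by auto
        then show ?thesis using mini(3)[of "i - 1"] by simp
      qed
      then have "\<bar>\<theta>a (s i) - \<theta>d (s i)\<bar> \<le> ?w i"
        using mini(2)[OF i] i by (intro node_interval_dist_le less_imp_le[OF assms(5)]) auto
      then have "\<rho> * \<bar>\<theta>a (s i) - \<theta>d (s i)\<bar> \<le> \<rho> * ?w i"
        using assms(3) by (intro mult_left_mono) auto
      moreover have "\<phi> (s i) = \<theta>a (s i)"
        using i False by (intro \<phi>) auto
      moreover have "?d i (\<theta>a (s i)) (\<theta>a (s (i + 1)))
          \<le> \<rho> * \<bar>\<theta>a (s i) - \<theta>d (s i)\<bar> + ?d i (\<theta>d (s i)) (\<theta>a (s (i + 1)))"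
        unfolding wp_dist_def by (rule rs_dist_turn_le[OF assms(3)])
      ultimately show ?thesis
        using next_angle False by simp
    qed
  qed
  also have "\<dots> = Cost_lb + \<rho> * (\<Sum>i=2..n - 1. ?w i)"
  proof -
    have "{1..n - 1} = insert 1 {2..n - 1}" using assms(1) by auto
    then have "(\<Sum>i=1..n - 1. if i = 1 then 0 else \<rho> * ?w i) = (\<Sum>i=2..n - 1. \<rho> * ?w i)"
      by simp
    moreover have "Cost_lb = (\<Sum>i=1..n - 1. ?d i (\<theta>d (s i)) (\<theta>a (s (i + 1))))"
      unfolding lb by (rule sum.cong[OF refl]) (simp only: mini(1) fst_conv)
    ultimately show ?thesis
      by (simp add: sum.distrib sum_distrib_left)
  qed
  \<comment> \<open>The sum of the widths is nonnegative, so the factor 1 may be relaxed to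
    3.\<close>
  also have "\<dots> \<le> Cost_lb + 3 * \<rho> * (\<Sum>i=2..n - 1. ?w i)"
  proof -
    have "0 \<le> ?w i" if "i \<in> {2..n - 1}" for i
    proof -
      have "lo (s i) < hi (s i)" using that by (intro assms(5)) auto
      then show ?thesis by simp
    qed
    then have "0 \<le> (\<Sum>i=2..n - 1. ?w i)" by (rule sum_nonneg)
    then show ?thesis using assms(3) by simp
  qed
  finally show ?thesis .
qed

end
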